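(* The following decision problem is undecidable: given a universal Horn sentence $\Phi$ over a finite relational signature $\tau$, decide whether the class $\mathrm{Mod}(\Phi)$ of all finite models of $\Phi$ has the joint embedding property. The problem remains undecidable even when every relation symbol in $\tau$ has arity at most two.
   Context: Formulas are first-order over a finite relational signature $\tau$ and do not use equality atoms (atomic formulas are only of the form $R(x_1,\dots,x_n)$ with $R\in\tau$). A universal sentence is Horn if its quantifier-free part is a conjunction of Horn clauses, i.e., disjunctions of atomic and negated atomic formulas with at most one positive disjunct. $\mathrm{Mod}(\Phi)$ denotes the class of all finite $\tau$-structures satisfying $\Phi$. A class $\mathcal{C}$ of $\tau$-structures has the joint embedding property (JEP) if for all $\mathfrak{B}_1,\mathfrak{B}_2\in\mathcal{C}$ there is $\mathfrak{C}\in\mathcal{C}$ with embeddings $\mathfrak{B}_1\hookrightarrow\mathfrak{C}$ and $\mathfrak{B}_2\hookrightarrow\mathfrak{C}$. *)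

theory Defs
  imports Main "HOL-Library.Nat_Bijection"
begin

datatype recf =
    Z
  | S
  | Id nat
  | Cn recf "recf list"
  | Pr recf recf
  | Mn recf

inductive rec_eval :: "recf \<Rightarrow> nat list \<Rightarrow> nat \<Rightarrow> bool" where
  ev_Z:  "rec_eval Z xs 0"
| ev_S:  "rec_eval S (x # xs) (Suc x)"
| ev_Id: "i < length xs \<Longrightarrow> rec_eval (Id i) xs (xs ! i)"
| ev_Cn: "list_all2 (\<lambda>g y. rec_eval g xs y) gs ys \<Longrightarrow> rec_eval f ys z
          \<Longrightarrow> rec_eval (Cn f gs) xs z"
| ev_Pr0: "rec_eval f xs y \<Longrightarrow> rec_eval (Pr f g) (0 # xs) y"
| ev_PrS: "rec_eval (Pr f g) (n # xs) y \<Longrightarrow> rec_eval g (n # y # xs) z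
          \<Longrightarrow> rec_eval (Pr f g) (Suc n # xs) z"
| ev_Mn: "rec_eval f (n # xs) 0 \<Longrightarrow> (\<forall>m<n. \<exists>k. rec_eval f (m # xs) (Suc k))
          \<Longrightarrow> rec_eval (Mn f) xs n"

text \<open>A finite relational signature is a list of arities; relation symbol R is an
  index R < length sig with arity sig ! R. Variables are natural numbers.
  An atom R(x1,...,xn) is a pair (R, [x1,...,xn]). A Horn clause is a pair
  (negative atoms, optional positive atom). A universal Horn sentence is a
  list of Horn clauses, read as the universal closure of their conjunction.\<close>

type_synonym signature = "nat list"
type_synonym atom = "nat \<times> nat list"
type_synonym horn_clause = "atom list \<times> atom option"
type_synonym horn_sentence = "horn_clause list"

definition wf_atom :: "signature \<Rightarrow> atom \<Rightarrow> bool" where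
  "wf_atom sig a \<longleftrightarrow> fst a < length sig \<and> length (snd a) = sig ! fst a"

definition wf_clause :: "signature \<Rightarrow> horn_clause \<Rightarrow> bool" where
  "wf_clause sig c \<longleftrightarrow> (\<forall>a\<in>set (fst c). wf_atom sig a) \<and> (\<forall>a\<in>set_option (snd c). wf_atom sig a)"

definition wf_sentence :: "signature \<Rightarrow> horn_sentence \<Rightarrow> bool" where
  "wf_sentence sig \<Phi> \<longleftrightarrow> (\<forall>c\<in>set \<Phi>. wf_clause sig c)"

text \<open>A structure is a carrier A (here a set of naturals; all notions below are
  isomorphism invariant) together with an interpretation I, where I R xs says that
  the tuple xs belongs to the relation R.\<close>

definition finite_structure :: "nat set \<Rightarrow> bool" where
  "finite_structure A \<longleftrightarrow> finite A \<and> A \<noteq> {}"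

definition holds_atom :: "(nat \<Rightarrow> nat list \<Rightarrow> bool) \<Rightarrow> (nat \<Rightarrow> nat) \<Rightarrow> atom \<Rightarrow> bool" where
  "holds_atom I v a \<longleftrightarrow> I (fst a) (map v (snd a))"

definition holds_clause :: "(nat \<Rightarrow> nat list \<Rightarrow> bool) \<Rightarrow> (nat \<Rightarrow> nat) \<Rightarrow> horn_clause \<Rightarrow> bool" where
  "holds_clause I v c \<longleftrightarrow>
     ((\<forall>a\<in>set (fst c). holds_atom I v a) \<longrightarrow>
        (case snd c of None \<Rightarrow> False | Some a \<Rightarrow> holds_atom I v a))"

definition satisfies :: "nat set \<Rightarrow> (nat \<Rightarrow> nat list \<Rightarrow> bool) \<Rightarrow> horn_sentence \<Rightarrow> bool" where
  "satisfies A I \<Phi> \<longleftrightarrow> (\<forall>v. range v \<subseteq> A \<longrightarrow> (\<forall>c\<in>set \<Phi>. holds_clause I v c))"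

definition is_finite_model :: "horn_sentence \<Rightarrow> nat set \<Rightarrow> (nat \<Rightarrow> nat list \<Rightarrow> bool) \<Rightarrow> bool" where
  "is_finite_model \<Phi> A I \<longleftrightarrow> finite_structure A \<and> satisfies A I \<Phi>"

definition embedding :: "signature \<Rightarrow> nat set \<Rightarrow> (nat \<Rightarrow> nat list \<Rightarrow> bool)
    \<Rightarrow> nat set \<Rightarrow> (nat \<Rightarrow> nat list \<Rightarrow> bool) \<Rightarrow> (nat \<Rightarrow> nat) \<Rightarrow> bool" where
  "embedding sig A IA B IB f \<longleftrightarrow>
     inj_on f A \<and> f ` A \<subseteq> B \<and>
     (\<forall>R < length sig. \<forall>xs. length xs = sig ! R \<and> set xs \<subseteq> A \<longrightarrow>
         (IA R xs \<longleftrightarrow> IB R (map f xs)))"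

definition has_JEP :: "signature \<Rightarrow> horn_sentence \<Rightarrow> bool" where
  "has_JEP sig \<Phi> \<longleftrightarrow>
     (\<forall>A1 I1 A2 I2. is_finite_model \<Phi> A1 I1 \<longrightarrow> is_finite_model \<Phi> A2 I2 \<longrightarrow>
        (\<exists>C IC f g. is_finite_model \<Phi> C IC \<and>
                    embedding sig A1 I1 C IC f \<and> embedding sig A2 I2 C IC g))"

definition enc_atom :: "atom \<Rightarrow> nat" where
  "enc_atom a = prod_encode (fst a, list_encode (snd a))"

definition enc_clause :: "horn_clause \<Rightarrow> nat" where
  "enc_clause c = prod_encode (list_encode (map enc_atom (fst c)),
                               (case snd c of None \<Rightarrow> 0 | Some a \<Rightarrow> Suc (enc_atom a)))"

definition enc_instance :: "signature \<Rightarrow> horn_sentence \<Rightarrow> nat" where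
  "enc_instance sig \<Phi> = prod_encode (list_encode sig, list_encode (map enc_clause \<Phi>))"

definition JEP_decidable_on :: "(signature \<Rightarrow> horn_sentence \<Rightarrow> bool) \<Rightarrow> bool" where
  "JEP_decidable_on P \<longleftrightarrow>
     (\<exists>f. \<forall>sig \<Phi>. wf_sentence sig \<Phi> \<and> P sig \<Phi> \<longrightarrow>
           rec_eval f [enc_instance sig \<Phi>] (if has_JEP sig \<Phi> then 1 else 0))"

end

theory Submission
  imports Defs "HOL-Library.Countable"
begin

text \<open>Evaluation of a recursive function F is described by finitely many Datalog rules on
  tuples of numbers. In a structure, numbers are successor chains and tuples are elements
  with projections, so binary relations suffice; a derivable Neq stands in for the missing
  equality. A derived fact r(ns) becomes a pair Good(t, u), where t is a tuple and u an arbitrary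
  element. A finite model may contain such pairs without justification, but when two models are
  put side by side, a pair with t and u in different models only holds if it was
  derived. The only other clause that matters forbids Good(t, u) for the goal tuple t if u is
  marked, so that joint embedding fails exactly if the goal fact is derivable.

  Now let f decide the JEP. The goal clause for the pair (s, x) is computable from (s, x). Let s and
  x be the codes of the signature and of the remaining clauses belonging to the function F that
  maps (s, x) to the answer of f on the sentence extended by the goal clause for (s, x). This
  sentence has the JEP if and only if F(s, x) is not 1, that is, if and only if f denies it.
  As codes of sentences serve as codes of programs, no universal machine is needed.\<close>

section \<open>Recursive functions\<close>

text \<open>The first assumption has the form of the induction hypothesis that rule induction
  provides for the argument list in the \<open>ev_Cn\<close> case.\<close>

lemma list_all2_unique:
  assumes "list_all2 (\<lambda>g y. R g y \<and> (\<forall>z. R g z \<longrightarrow> y = z)) gs ys" "list_all2 R gs zs"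
  shows "ys = zs"
proof (rule nth_equalityI)
  show "length ys = length zs"
    using assms[THEN list_all2_lengthD] by simp
  show "ys ! i = zs ! i" if "i < length ys" for i
    using assms that by (auto simp: list_all2_conv_all_nth)
qed

lemma rec_eval_deterministic:
  "rec_eval e xs y \<Longrightarrow> rec_eval e xs z \<Longrightarrow> y = z"
proof (induction arbitrary: z rule: rec_eval.induct)
  case (ev_Z xs)
  from ev_Z.prems show ?case by cases auto
next
  case (ev_S x xs)
  from ev_S.prems show ?case by cases auto
next
  case (ev_Id i xs)
  from ev_Id.prems show ?case by cases auto
next
  case (ev_Cn xs gs ys f w)
  from ev_Cn.prems obtain zs where zs: "list_all2 (\<lambda>g y. rec_eval g xs y) gs zs" "rec_eval f zs z"
    by cases auto
  have "ys = zs"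
    using list_all2_unique[OF ev_Cn.IH(1) zs(1)] .
  then show ?case using ev_Cn.IH(2) zs(2) by auto
next
  case (ev_Pr0 f xs y g)
  from ev_Pr0.prems show ?case by cases (use ev_Pr0.IH in auto)
next
  case (ev_PrS f g n xs y w)
  from ev_PrS.prems show ?case by cases (use ev_PrS.IH in auto)
next
  case (ev_Mn f n xs)
  from ev_Mn.prems have z: "rec_eval f (z # xs) 0" "\<forall>m<z. \<exists>k. rec_eval f (m # xs) (Suc k)"
    by (cases; auto)+
  have "\<not> n < z" using ev_Mn.IH(1) z(2) by fastforce
  moreover have "\<not> z < n" using ev_Mn.IH(2) z(1) by fastforce
  ultimately show ?case by simp
qed

lemma rec_eval_Cn1: "rec_eval g xs a \<Longrightarrow> rec_eval f [a] z \<Longrightarrow> rec_eval (Cn f [g]) xs z"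
  by (rule ev_Cn[where ys = "[a]"]) auto

lemma rec_eval_Cn2:
  "rec_eval g xs a \<Longrightarrow> rec_eval h xs b \<Longrightarrow> rec_eval f [a, b] z \<Longrightarrow> rec_eval (Cn f [g, h]) xs z"
  by (rule ev_Cn[where ys = "[a, b]"]) auto

lemma rec_eval_Id: "i < length xs \<Longrightarrow> xs ! i = y \<Longrightarrow> rec_eval (Id i) xs y"
  using ev_Id by blast

lemma rec_eval_Suc: "rec_eval e xs y \<Longrightarrow> rec_eval (Cn S [e]) xs (Suc y)"
  by (rule rec_eval_Cn1) (auto intro: ev_S)

primrec const_recf :: "nat \<Rightarrow> recf" where
  "const_recf 0 = Z"
| "const_recf (Suc n) = Cn S [const_recf n]"

lemma rec_eval_const: "rec_eval (const_recf n) xs n"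
  by (induction n) (auto intro: ev_Z rec_eval_Suc)

definition add_recf :: recf where
  "add_recf = Pr (Id 0) (Cn S [Id 1])"

lemma rec_eval_add: "rec_eval add_recf [m, n] (m + n)"
proof (induction m)
  case 0
  show ?case unfolding add_recf_def by (auto intro!: ev_Pr0 rec_eval_Id)
next
  case (Suc m)
  then show ?case unfolding add_recf_def
    by (auto intro!: ev_PrS[where y = "m + n"] rec_eval_Suc rec_eval_Id)
qed

definition triangle_recf :: recf where
  "triangle_recf = Pr Z (Cn add_recf [Id 1, Cn S [Id 0]])"

lemma rec_eval_triangle: "rec_eval triangle_recf [n] (triangle n)"
proof (induction n)
  case 0
  show ?case unfolding triangle_recf_def by (auto intro!: ev_Pr0 ev_Z)
next
  case (Suc n)
  have "rec_eval (Cn add_recf [Id 1, Cn S [Id 0]]) [n, triangle n] (triangle n + Suc n)"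
    by (rule rec_eval_Cn2[OF _ _ rec_eval_add]) (auto intro!: rec_eval_Suc rec_eval_Id)
  with Suc show ?case unfolding triangle_recf_def
    by (auto intro!: ev_PrS[where y = "triangle n"])
qed

text \<open>Cantor pairing: \<open>prod_encode (m, n)\<close> is
  \<open>triangle (m + n) + m\<close>.\<close>

definition pair_recf :: "recf \<Rightarrow> recf \<Rightarrow> recf" where
  "pair_recf a b = Cn add_recf [Cn triangle_recf [Cn add_recf [a, b]], a]"

lemma rec_eval_pair:
  assumes "rec_eval a xs m" "rec_eval b xs n"
  shows "rec_eval (pair_recf a b) xs (prod_encode (m, n))"
  unfolding pair_recf_def prod_encode_def using assms
  by (auto intro!: rec_eval_Cn2 rec_eval_Cn1 rec_eval_add rec_eval_triangle)

definition cons_recf :: "recf \<Rightarrow> recf \<Rightarrow> recf" where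
  "cons_recf a b = Cn S [pair_recf a b]"

lemma rec_eval_cons:
  assumes "rec_eval a xs m" "rec_eval b xs (list_encode ns)"
  shows "rec_eval (cons_recf a b) xs (list_encode (m # ns))"
  unfolding cons_recf_def using rec_eval_Suc[OF rec_eval_pair[OF assms]] by simp

definition atom_recf :: "nat \<Rightarrow> recf \<Rightarrow> recf \<Rightarrow> recf" where
  "atom_recf R a b = pair_recf (const_recf R) (cons_recf a (cons_recf b Z))"

lemma rec_eval_atom:
  assumes "rec_eval a xs m" "rec_eval b xs n"
  shows "rec_eval (atom_recf R a b) xs (enc_atom (R, [m, n]))"
proof -
  have "rec_eval (cons_recf b Z) xs (list_encode [n])"
    using rec_eval_cons[OF assms(2), of Z "[]"] by (simp add: ev_Z)
  from rec_eval_pair[OF rec_eval_const rec_eval_cons[OF assms(1) this]]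
  show ?thesis by (simp add: atom_recf_def enc_atom_def)
qed

section \<open>Rules on tuples of numbers\<close>

text \<open>The variables of a rule are numbers: \<open>zeros\<close> lists those constrained to be 0, and a pair
  (x, y) in \<open>succs\<close> says that x = y + 1.\<close>

datatype rule = Rule (zeros: "nat list") (succs: "(nat \<times> nat) list")
  (body: "(nat \<times> nat list) list") (head: "nat \<times> nat list")

definition rule_vars :: "rule \<Rightarrow> nat list" where
  "rule_vars \<rho> = zeros \<rho> @ map fst (succs \<rho>) @ map snd (succs \<rho>)
     @ concat (map snd (body \<rho>)) @ snd (head \<rho>)"

definition fires :: "(nat \<Rightarrow> nat list \<Rightarrow> bool) \<Rightarrow> (nat \<Rightarrow> nat) \<Rightarrow> rule \<Rightarrow> bool" where
  "fires G v \<rho> \<longleftrightarrow> (\<forall>x\<in>set (zeros \<rho>). v x = 0) \<and> (\<forall>(x, y)\<in>set (succs \<rho>). v x = Suc (v y))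
     \<and> (\<forall>(r, ts)\<in>set (body \<rho>). G r (map v ts))"

text \<open>Only the values of the rule variables are bounded, because a finite successor chain
  represents no number beyond its length.\<close>

definition closed_upto :: "nat \<Rightarrow> rule list \<Rightarrow> (nat \<Rightarrow> nat list \<Rightarrow> bool) \<Rightarrow> bool" where
  "closed_upto N P G \<longleftrightarrow> (\<forall>\<rho>\<in>set P. \<forall>v. (\<forall>x\<in>set (rule_vars \<rho>). v x \<le> N) \<longrightarrow> fires G v \<rho> \<longrightarrow>
     G (fst (head \<rho>)) (map v (snd (head \<rho>))))"

text \<open>The bound N makes derivability witnessed by a finite structure.\<close>

definition derivable :: "rule list \<Rightarrow> nat \<Rightarrow> nat list \<Rightarrow> bool" where
  "derivable P r ns \<longleftrightarrow> (\<exists>N. \<forall>G. closed_upto N P G \<longrightarrow> G r ns)"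

lemma closed_upto_antimono: "closed_upto N P G \<Longrightarrow> N' \<le> N \<Longrightarrow> closed_upto N' P G"
  unfolding closed_upto_def by (meson order_trans)

text \<open>A rule has finitely many body facts and variables, so the maximum of the bounds of the
  former and the values of the latter is a bound for the head.\<close>

lemma derivable_rule:
  assumes \<rho>: "\<rho> \<in> set P" and fires: "fires (derivable P) v \<rho>"
  shows "derivable P (fst (head \<rho>)) (map v (snd (head \<rho>)))"
proof -
  have "\<forall>b\<in>set (body \<rho>). \<exists>N. \<forall>G. closed_upto N P G \<longrightarrow> G (fst b) (map v (snd b))"
    using fires unfolding fires_def derivable_def by (auto simp: case_prod_unfold)
  then obtain Nb where Nb: "\<And>b G. b \<in> set (body \<rho>) \<Longrightarrow> closed_upto (Nb b) P G \<Longrightarrow> G (fst b) (map v (snd b))"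
    by (auto dest!: bchoice)
  define N where "N = Max (insert 0 (Nb ` set (body \<rho>) \<union> v ` set (rule_vars \<rho>)))"
  have N: "\<And>b. b \<in> set (body \<rho>) \<Longrightarrow> Nb b \<le> N" "\<And>x. x \<in> set (rule_vars \<rho>) \<Longrightarrow> v x \<le> N"
    unfolding N_def by (auto intro!: Max_ge)
  have "G (fst (head \<rho>)) (map v (snd (head \<rho>)))" if G: "closed_upto N P G" for G
  proof -
    have "fires G v \<rho>"
      using fires Nb closed_upto_antimono[OF G N(1)] unfolding fires_def
      by (fastforce simp: case_prod_unfold)
    then show ?thesis using G \<rho> N(2) unfolding closed_upto_def by blast
  qed
  then show ?thesis unfolding derivable_def by blast
qed

lemma derivable_mono:
  assumes "derivable P r ns" "set P \<subseteq> set Q"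
  shows "derivable Q r ns"
proof -
  have "closed_upto N Q G \<Longrightarrow> closed_upto N P G" for N G
    using assms(2) unfolding closed_upto_def by blast
  then show ?thesis using assms(1) unfolding derivable_def by blast
qed

text \<open>Closure under all firings gives closure up to every bound, in particular up to the one
  that witnesses derivability.\<close>

lemma derivable_induct:
  assumes "derivable P r ns"
    and "\<And>\<rho> v. \<rho> \<in> set P \<Longrightarrow> fires G v \<rho> \<Longrightarrow> G (fst (head \<rho>)) (map v (snd (head \<rho>)))"
  shows "G r ns"
  using assms unfolding derivable_def closed_upto_def by blast

section \<open>Compiling recursive functions into rules\<close>

instance recf :: countable
  by countable_datatype

text \<open>The relation \<open>graph_rel e\<close> holds of y # xs if e maps xs to y, and \<open>search_rel f\<close> holds of
  m # xs if f is positive at i # xs for all i < m.\<close>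

definition graph_rel :: "recf \<Rightarrow> nat" where
  "graph_rel e = 1 + 2 * to_nat e"

definition search_rel :: "recf \<Rightarrow> nat" where
  "search_rel e = 2 + 2 * to_nat e"

lemma rel_eq_iff [simp]:
  "graph_rel e = graph_rel e' \<longleftrightarrow> e = e'" "search_rel e = search_rel e' \<longleftrightarrow> e = e'"
  "graph_rel e \<noteq> search_rel e'" "search_rel e \<noteq> graph_rel e'"
  "graph_rel e \<noteq> 0" "search_rel e \<noteq> 0" "0 \<noteq> graph_rel e" "0 \<noteq> search_rel e"
  unfolding graph_rel_def search_rel_def by (auto, presburger+)

text \<open>The arity \<open>n\<close> is a parameter because \<open>Z\<close>, \<open>Id\<close>
  and the combinators have no fixed arity. Variables 1 to n are the arguments and 0 is the result,
  except that for \<open>Id\<close> the result is an argument variable itself. Intermediate values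
  use the variables from n + 1 on. In the \<open>search_rel\<close> rules, variable 0 is the search
  bound.\<close>

fun rules :: "recf \<Rightarrow> nat \<Rightarrow> rule list" where
  "rules Z n = [Rule [0] [] [] (graph_rel Z, [0..<Suc n])]"
| "rules S n = (if n = 0 then [] else [Rule [] [(0, 1)] [] (graph_rel S, [0..<Suc n])])"
| "rules (Id i) n = (if i < n then [Rule [] [] [] (graph_rel (Id i), Suc i # [1..<Suc n])] else [])"
| "rules (Cn f gs) n =
     Rule [] [] ((graph_rel f, 0 # [Suc n..<Suc n + length gs]) #
         map (\<lambda>j. (graph_rel (gs ! j), (Suc n + j) # [1..<Suc n])) [0..<length gs])
       (graph_rel (Cn f gs), [0..<Suc n])
     # rules f (length gs) @ concat (map (\<lambda>g. rules g n) gs)"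
| "rules (Pr f g) n = (case n of 0 \<Rightarrow> [] | Suc m \<Rightarrow>
     Rule [1] [] [(graph_rel f, 0 # [2..<m + 2])] (graph_rel (Pr f g), [0..<m + 2])
     # Rule [] [(1, m + 2)] [(graph_rel (Pr f g), (m + 3) # (m + 2) # [2..<m + 2]),
           (graph_rel g, 0 # (m + 2) # (m + 3) # [2..<m + 2])] (graph_rel (Pr f g), [0..<m + 2])
     # rules f m @ rules g (m + 2))"
| "rules (Mn f) n =
     Rule [0] [] [] (search_rel f, [0..<Suc n])
     # Rule [] [(0, n + 1), (n + 2, n + 3)] [(search_rel f, (n + 1) # [1..<Suc n]),
           (graph_rel f, (n + 2) # (n + 1) # [1..<Suc n])] (search_rel f, [0..<Suc n])
     # Rule [n + 1] [] [(search_rel f, [0..<Suc n]), (graph_rel f, (n + 1) # [0..<Suc n])]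
         (graph_rel (Mn f), [0..<Suc n])
     # rules f (Suc n)"


lemma map_nth_slice: "b \<le> length ys \<Longrightarrow> map ((!) ys) [a..<b] = take (b - a) (drop a ys)"
  by (rule nth_equalityI) auto

text \<open>The intended interpretation. The predicate \<open>Q\<close> stays open because
  \<open>rules\<close> never mentions relation 0; it is fixed only once \<open>program\<close> adds
  a rule for that relation.\<close>

definition meaning :: "(nat list \<Rightarrow> bool) \<Rightarrow> nat \<Rightarrow> nat list \<Rightarrow> bool" where
  "meaning Q r ns \<longleftrightarrow> (r = 0 \<longrightarrow> Q ns)
     \<and> (\<forall>e. r = graph_rel e \<longrightarrow> (\<exists>y xs. ns = y # xs \<and> rec_eval e xs y))
     \<and> (\<forall>f. r = search_rel f \<longrightarrow>
          (\<exists>m xs. ns = m # xs \<and> (\<forall>i<m. \<exists>k. rec_eval f (i # xs) (Suc k))))"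

lemma meaning_simps [simp]:
  "meaning Q 0 ns \<longleftrightarrow> Q ns"
  "meaning Q (graph_rel e) ns \<longleftrightarrow> (\<exists>y xs. ns = y # xs \<and> rec_eval e xs y)"
  "meaning Q (search_rel f) ns \<longleftrightarrow>
     (\<exists>m xs. ns = m # xs \<and> (\<forall>i<m. \<exists>k. rec_eval f (i # xs) (Suc k)))"
  unfolding meaning_def by auto

text \<open>Each rule transcribes an evaluation clause or extends a search by one argument, so the
  intended interpretation is closed under it.\<close>

lemma rules_sound:
  assumes "\<rho> \<in> set (rules e n)" "fires (meaning Q) v \<rho>"
  shows "meaning Q (fst (head \<rho>)) (map v (snd (head \<rho>)))"
  using assms
proof (induction e n rule: rules.induct)
  case (1 n)
  then show ?case by (auto simp: fires_def upt_conv_Cons ev_Z simp del: upt_Suc)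
next
  case (2 n)
  then show ?case by (auto simp: fires_def upt_conv_Cons ev_S simp del: upt_Suc split: if_splits)
next
  case (3 i n)
  then show ?case by (auto simp: fires_def simp del: upt_Suc split: if_splits intro!: rec_eval_Id)
next
  case (4 f gs n)
  let ?ys = "map v [Suc n..<Suc n + length gs]" and ?xs = "map v [1..<Suc n]"
  from 4(3) consider "\<rho> \<in> set (rules f (length gs))" | g where "g \<in> set gs" "\<rho> \<in> set (rules g n)"
    | "\<rho> = Rule [] [] ((graph_rel f, 0 # [Suc n..<Suc n + length gs]) #
         map (\<lambda>j. (graph_rel (gs ! j), (Suc n + j) # [1..<Suc n])) [0..<length gs])
       (graph_rel (Cn f gs), [0..<Suc n])"
    by auto
  then show ?case
  proof cases
    case 1 then show ?thesis using 4 by blast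
  next
    case 2 then show ?thesis using 4 by blast
  next
    case 3
    have "rec_eval f ?ys (v 0)" "\<forall>j<length gs. rec_eval (gs ! j) ?xs (v (Suc n + j))"
      using 4(4) unfolding 3 by (auto simp: fires_def simp del: upt_Suc)
    then have "rec_eval (Cn f gs) ?xs (v 0)"
      by (intro ev_Cn[where ys = ?ys]) (auto simp: list_all2_conv_all_nth simp del: upt_Suc)
    then show ?thesis unfolding 3 by (simp add: upt_conv_Cons del: upt_Suc)
  qed
next
  case (5 f g n)
  then obtain m where n: "n = Suc m" by (auto split: nat.splits)
  from 5(3) consider "\<rho> \<in> set (rules f m)" | "\<rho> \<in> set (rules g (m + 2))"
    | "\<rho> = Rule [1] [] [(graph_rel f, 0 # [2..<m + 2])] (graph_rel (Pr f g), [0..<m + 2])"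
    | "\<rho> = Rule [] [(1, m + 2)] [(graph_rel (Pr f g), (m + 3) # (m + 2) # [2..<m + 2]),
           (graph_rel g, 0 # (m + 2) # (m + 3) # [2..<m + 2])] (graph_rel (Pr f g), [0..<m + 2])"
    by (auto simp: n)
  then show ?case
  proof cases
    case 1 then show ?thesis using 5 n by blast
  next
    case 2 then show ?thesis using 5 n by blast
  next
    case 3
    then show ?thesis using 5(4)
      by (auto simp: fires_def upt_conv_Cons numeral_2_eq_2 ev_Pr0 simp del: upt_Suc)
  next
    case 4
    then show ?thesis using 5(4)
      by (auto simp: fires_def upt_conv_Cons numeral_2_eq_2 simp del: upt_Suc intro: ev_PrS)
  qed
next
  case (6 f n)
  let ?xs = "map v [1..<Suc n]"
  from 6(2) consider "\<rho> \<in> set (rules f (Suc n))"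
    | "\<rho> = Rule [0] [] [] (search_rel f, [0..<Suc n])"
    | "\<rho> = Rule [] [(0, n + 1), (n + 2, n + 3)] [(search_rel f, (n + 1) # [1..<Suc n]),
           (graph_rel f, (n + 2) # (n + 1) # [1..<Suc n])] (search_rel f, [0..<Suc n])"
    | "\<rho> = Rule [n + 1] [] [(search_rel f, [0..<Suc n]), (graph_rel f, (n + 1) # [0..<Suc n])]
         (graph_rel (Mn f), [0..<Suc n])"
    by auto
  then show ?case
  proof cases
    case 1 then show ?thesis using 6 by blast
  next
    case 2
    then show ?thesis using 6(3) by (auto simp: fires_def upt_conv_Cons simp del: upt_Suc)
  next
    case 3
    have upt: "[0..<Suc n] = 0 # [1..<Suc n]"
      by (simp add: upt_conv_Cons del: upt_Suc)
    show ?thesis using 6(3) unfolding 3 upt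
      by (auto simp: fires_def less_Suc_eq simp del: upt_Suc)
  next
    case 4
    then show ?thesis using 6(3)
      by (auto simp: fires_def upt_conv_Cons simp del: upt_Suc intro: ev_Mn)
  qed
qed

text \<open>Induction on the evaluation, firing the rule that belongs to its last clause. The
  valuation is a list indexed by variables: the result, the arguments, then the intermediate values
  in the order fixed by \<open>rules\<close>.\<close>

lemma rules_complete:
  "rec_eval e xs y \<Longrightarrow> derivable (rules e (length xs)) (graph_rel e) (y # xs)"
proof (induction rule: rec_eval.induct)
  case (ev_Z xs)
  show ?case
    using derivable_rule[of "hd (rules Z (length xs))" "rules Z (length xs)" "(!) (0 # xs)"]
    by (simp add: fires_def map_nth_slice del: upt_Suc)
next
  case (ev_S x xs)
  show ?case
    using derivable_rule[of "hd (rules S (length (x # xs)))" "rules S (length (x # xs))" "(!) (Suc x # x # xs)"]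
    by (simp add: fires_def map_nth_slice del: upt_Suc)
next
  case (ev_Id i xs)
  then show ?case
    \<comment> \<open>The leading 0 only fills the position of variable 0, which does not occur in
      this rule.\<close>
    using derivable_rule[of "hd (rules (Id i) (length xs))" "rules (Id i) (length xs)" "(!) (0 # xs)"]
    by (simp add: fires_def map_nth_slice del: upt_Suc)
next
  case (ev_Cn xs gs ys f z)
  let ?n = "length xs" and ?v = "(!) (z # xs @ ys)"
  let ?P = "rules (Cn f gs) ?n"
  let ?\<rho> = "hd ?P"
  have len: "length ys = length gs" using ev_Cn.IH(1) by (auto dest: list_all2_lengthD)
  have 1: "derivable ?P (graph_rel f) (z # ys)"
    using ev_Cn.IH(2) by (rule derivable_mono) (auto simp: len)
  have 2: "derivable ?P (graph_rel (gs ! j)) (ys ! j # xs)" if "j < length gs" for j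
  proof (rule derivable_mono)
    show "derivable (rules (gs ! j) ?n) (graph_rel (gs ! j)) (ys ! j # xs)"
      using ev_Cn.IH(1) that by (auto simp: list_all2_conv_all_nth)
    show "set (rules (gs ! j) ?n) \<subseteq> set ?P"
      using that by (auto intro!: bexI[of _ "gs ! j"])
  qed
  have "fires (derivable ?P) ?v ?\<rho>"
    using 1 2 by (auto simp: fires_def map_nth_slice len nth_append simp del: upt_Suc)
  from derivable_rule[OF _ this] show ?case
    by (simp add: map_nth_slice del: upt_Suc)
next
  case (ev_Pr0 f xs y g)
  let ?P = "rules (Pr f g) (length (0 # xs))"
  have "derivable ?P (graph_rel f) (y # xs)"
    using ev_Pr0.IH by (rule derivable_mono) auto
  then show ?case
    using derivable_rule[of "hd ?P" ?P "(!) (y # 0 # xs)"]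
    by (simp add: fires_def map_nth_slice del: upt_Suc)
next
  case (ev_PrS f g n xs y z)
  let ?P = "rules (Pr f g) (length (Suc n # xs))" and ?v = "(!) (z # Suc n # xs @ [n, y])"
  have "derivable ?P (graph_rel (Pr f g)) (y # n # xs)"
    using ev_PrS.IH(1) by simp
  moreover have "derivable ?P (graph_rel g) (z # n # y # xs)"
    using ev_PrS.IH(2) by (rule derivable_mono) auto
  ultimately show ?case
    using derivable_rule[of "?P ! 1" ?P ?v]
    by (simp add: fires_def map_nth_slice nth_append del: upt_Suc)
next
  case (ev_Mn f n xs)
  let ?P = "rules (Mn f) (length xs)"
  have f: "derivable ?P (graph_rel f) (y # m # xs)"
    if "derivable (rules f (length (m # xs))) (graph_rel f) (y # m # xs)" for y m
    using that by (rule derivable_mono) auto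
  \<comment> \<open>The bounded quantifier of \<open>ev_Mn\<close> becomes a chain of search facts,
    each extending the previous one by one positive value.\<close>
  have search: "derivable ?P (search_rel f) (m # xs)" if "m \<le> n" for m
    using that
  proof (induction m)
    case 0
    show ?case
      using derivable_rule[of "?P ! 0" ?P "(!) (0 # xs)"]
      by (simp add: fires_def map_nth_slice del: upt_Suc)
  next
    case (Suc m)
    then obtain k where "derivable ?P (graph_rel f) (Suc k # m # xs)"
      using ev_Mn.IH(2) f by (meson Suc_le_lessD)
    with Suc show ?case
      using derivable_rule[of "?P ! 1" ?P "(!) (Suc m # xs @ [m, Suc k, k])"]
      by (simp add: fires_def map_nth_slice nth_append del: upt_Suc)
  qed
  show ?case
    using derivable_rule[of "?P ! 2" ?P "(!) (n # xs @ [0])"] search[of n] f[OF ev_Mn.IH(1)]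
    by (simp add: fires_def map_nth_slice nth_append del: upt_Suc)
qed

text \<open>Adds an input relation for "the value at two arguments is 1", whose name 0
  does not depend on the program, so that the program may mention it without circularity.\<close>

definition program :: "recf \<Rightarrow> rule list" where
  "program F = Rule [3] [(2, 3)] [(graph_rel F, [2, 0, 1])] (0, [0, 1]) # rules F 2"

lemma derivable_program: "derivable (program F) 0 [s, x] \<longleftrightarrow> rec_eval F [s, x] 1"
proof
  \<comment> \<open>The only rule with head relation 0 tests for the result 1, so this choice of
    \<open>?Q\<close> makes it sound.\<close>
  let ?Q = "\<lambda>ns. rec_eval F ns 1"
  assume "derivable (program F) 0 [s, x]"
  then have "meaning ?Q 0 [s, x]"
  proof (rule derivable_induct)
    fix \<rho> v
    assume "\<rho> \<in> set (program F)" and f: "fires (meaning ?Q) v \<rho>"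
    then consider "\<rho> = Rule [3] [(2, 3)] [(graph_rel F, [2, 0, 1])] (0, [0, 1])" | "\<rho> \<in> set (rules F 2)"
      by (auto simp: program_def)
    then show "meaning ?Q (fst (head \<rho>)) (map v (snd (head \<rho>)))"
      using f by cases (auto simp: fires_def intro: rules_sound)
  qed
  then show "rec_eval F [s, x] 1" by simp
next
  let ?P = "program F"
  assume "rec_eval F [s, x] 1"
  from rules_complete[OF this] have "derivable ?P (graph_rel F) [1, s, x]"
    by (rule derivable_mono) (auto simp: program_def numeral_2_eq_2)
  then show "derivable ?P 0 [s, x]"
    using derivable_rule[of "hd ?P" ?P "(!) [s, x, 1, 0]"]
    by (simp add: fires_def program_def)
qed


section \<open>The Horn sentence of a set of rules\<close>

text \<open>Relation symbols, all binary: 0 Zero (used as Zero(p, p)), 1 Succ(p, q) for p = q + 1,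
  2 Neq, 3 Num, 4 the marker (used as Marker(u, u)), 5 Link, and \<open>proj i\<close> relating a tuple to
  its i-th component. \<open>good r l\<close> is the relation Good for facts r(ns) with l components. Like
  Good, Num has an arbitrary element u as second argument.\<close>

definition proj :: "nat \<Rightarrow> nat" where
  "proj i = 6 + 2 * i"

definition good :: "nat \<Rightarrow> nat \<Rightarrow> nat" where
  "good r l = 7 + 2 * prod_encode (r, l)"

lemma symbol_eq_iff [simp]:
  "proj i = proj j \<longleftrightarrow> i = j" "good r l = good r' l' \<longleftrightarrow> r = r' \<and> l = l'"
  "proj i \<noteq> good r l" "good r l \<noteq> proj i"
  unfolding proj_def good_def by (auto, presburger+)

lemma symbol_neq [simp]:
  "0 \<noteq> proj i" "Suc 0 \<noteq> proj i" "2 \<noteq> proj i" "3 \<noteq> proj i" "4 \<noteq> proj i" "5 \<noteq> proj i"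
  "0 \<noteq> good r l" "Suc 0 \<noteq> good r l" "2 \<noteq> good r l" "3 \<noteq> good r l" "4 \<noteq> good r l" "5 \<noteq> good r l"
  unfolding proj_def good_def by auto

lemmas symbol_neq' [simp] = symbol_neq [symmetric]

text \<open>Neq becomes derivable between elements that represent different numbers. As it is
  irreflexive, an element represents at most one number, and the last clauses make projections
  unique up to the number represented. The Num clauses climb a successor chain with \<open>u\<close>
  arbitrary, so they also apply when \<open>u\<close> comes from another model.\<close>

definition base_clauses :: "nat \<Rightarrow> horn_sentence" where
  "base_clauses M =
    [([(2, [0, 0])], None),
     ([(0, [0, 0]), (1, [1, 2])], Some (2, [0, 1])),
     ([(0, [0, 0]), (1, [1, 2])], Some (2, [1, 0])),
     ([(1, [0, 1]), (1, [2, 3]), (2, [1, 3])], Some (2, [0, 2])),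
     ([(0, [0, 0])], Some (3, [0, 1])),
     ([(1, [0, 1]), (3, [1, 2])], Some (3, [0, 2]))]
    @ map (\<lambda>i. ([(proj i, [0, 1]), (proj i, [0, 2]), (2, [1, 2])], None)) [0..<M]"

definition tuple_atoms :: "nat \<Rightarrow> nat list \<Rightarrow> atom list" where
  "tuple_atoms t ts = map (\<lambda>i. (proj i, [t, 2 * ts ! i + 1])) [0..<length ts]"

text \<open>Variable 0 is u, variable 2 the head tuple, 2k + 4 the k-th body tuple and 2x + 1 the
  number variable x of the rule. The Link atoms (symbol 5) force everything except u into one
  of two models that are put side by side.\<close>

definition rule_clause :: "rule \<Rightarrow> horn_clause" where
  "rule_clause \<rho> =
    (map (\<lambda>x. (3, [2 * x + 1, 0])) (rule_vars \<rho>) @ map (\<lambda>x. (5, [2, 2 * x + 1])) (rule_vars \<rho>)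
     @ map (\<lambda>x. (0, [2 * x + 1, 2 * x + 1])) (zeros \<rho>)
     @ map (\<lambda>(x, y). (1, [2 * x + 1, 2 * y + 1])) (succs \<rho>)
     @ tuple_atoms 2 (snd (head \<rho>))
     @ concat (map (\<lambda>k. (5, [2, 2 * k + 4])
          # (good (fst (body \<rho> ! k)) (length (snd (body \<rho> ! k))), [2 * k + 4, 0])
          # tuple_atoms (2 * k + 4) (snd (body \<rho> ! k))) [0..<length (body \<rho>)]),
     Some (good (fst (head \<rho>)) (length (snd (head \<rho>))), [2, 0]))"

text \<open>Variable 0 is u, 1 the goal tuple, and i + 2 the number i.\<close>

definition goal_clause :: "nat \<Rightarrow> nat \<Rightarrow> horn_clause" where
  "goal_clause s x =
    ((proj 0, [1, s + 2]) # (proj 1, [1, x + 2])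
     # map (\<lambda>i. (1, [i + 3, i + 2])) (rev [0..<s + x])
     @ [(0, [2, 2]), (5, [1, 2]), (4, [0, 0]), (good 0 2, [1, 0])], None)"

definition horn :: "nat \<Rightarrow> rule list \<Rightarrow> horn_sentence" where
  "horn M P = base_clauses M @ map rule_clause P"

lemma holds_atom_pair: "holds_atom I v (R, [i, j]) \<longleftrightarrow> I R [v i, v j]"
  by (simp add: holds_atom_def)

lemma tuple_atoms_hold:
  "(\<forall>a\<in>set (tuple_atoms t ts). holds_atom I v a) \<longleftrightarrow>
     (\<forall>i<length ts. I (proj i) [v t, v (2 * ts ! i + 1)])"
  by (auto simp: tuple_atoms_def holds_atom_pair)

lemma rule_clause_body:
  "(\<forall>a\<in>set (fst (rule_clause \<rho>)). holds_atom I v a) \<longleftrightarrow>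
     (\<forall>x\<in>set (rule_vars \<rho>). I 3 [v (2 * x + 1), v 0] \<and> I 5 [v 2, v (2 * x + 1)])
     \<and> (\<forall>x\<in>set (zeros \<rho>). I 0 [v (2 * x + 1), v (2 * x + 1)])
     \<and> (\<forall>(x, y)\<in>set (succs \<rho>). I 1 [v (2 * x + 1), v (2 * y + 1)])
     \<and> (\<forall>i<length (snd (head \<rho>)). I (proj i) [v 2, v (2 * snd (head \<rho>) ! i + 1)])
     \<and> (\<forall>k<length (body \<rho>). I 5 [v 2, v (2 * k + 4)]
         \<and> I (good (fst (body \<rho> ! k)) (length (snd (body \<rho> ! k)))) [v (2 * k + 4), v 0]
         \<and> (\<forall>i<length (snd (body \<rho> ! k)). I (proj i) [v (2 * k + 4), v (2 * snd (body \<rho> ! k) ! i + 1)]))"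
  unfolding rule_clause_def
  by (simp add: ball_Un ball_conj_distrib tuple_atoms_hold holds_atom_pair case_prod_unfold) auto

lemma goal_clause_body:
  "(\<forall>a\<in>set (fst (goal_clause s x)). holds_atom I v a) \<longleftrightarrow>
     I (proj 0) [v 1, v (s + 2)] \<and> I (proj 1) [v 1, v (x + 2)]
     \<and> (\<forall>i<s + x. I 1 [v (i + 3), v (i + 2)])
     \<and> I 0 [v 2, v 2] \<and> I 5 [v 1, v 2] \<and> I 4 [v 0, v 0] \<and> I (good 0 2) [v 1, v 0]"
  unfolding goal_clause_def by (auto simp: ball_Un holds_atom_pair)

section \<open>Joint embedding if the goal is not derivable\<close>

primrec val :: "nat set \<Rightarrow> (nat \<Rightarrow> nat list \<Rightarrow> bool) \<Rightarrow> nat \<Rightarrow> nat \<Rightarrow> bool" where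
  "val A I 0 p \<longleftrightarrow> p \<in> A \<and> I 0 [p, p]"
| "val A I (Suc n) p \<longleftrightarrow> p \<in> A \<and> (\<exists>q. I 1 [p, q] \<and> val A I n q)"

lemma val_carrier: "val A I n p \<Longrightarrow> p \<in> A"
  by (cases n) auto

text \<open>Valuations are total, so the values of the finitely many variables of interest are
  padded with \<open>a\<close>.\<close>

lemma satisfies_inst:
  assumes "satisfies A I \<Phi>" "c \<in> set \<Phi>" "set (a # as) \<subseteq> A"
  shows "holds_clause I (\<lambda>i. if i < length (a # as) then (a # as) ! i else a) c"
proof -
  have "(if i < length (a # as) then (a # as) ! i else a) \<in> A" for i
    using assms(3) subsetD[OF assms(3) nth_mem[of i "a # as"]] by (cases "i < length (a # as)") simp_all
  then have "range (\<lambda>i. if i < length (a # as) then (a # as) ! i else a) \<subseteq> A"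
    by blast
  then show ?thesis using assms unfolding satisfies_def by blast
qed

lemma base_clauses_neq:
  assumes sat: "satisfies A I \<Phi>" and base: "set (base_clauses M) \<subseteq> set \<Phi>"
  shows "a \<in> A \<Longrightarrow> \<not> I 2 [a, a]"
    and "\<lbrakk>I 0 [a, a]; I 1 [b, c]; a \<in> A; b \<in> A; c \<in> A\<rbrakk> \<Longrightarrow> I 2 [a, b] \<and> I 2 [b, a]"
    and "\<lbrakk>I 1 [a, b]; I 1 [c, d]; I 2 [b, d]; a \<in> A; b \<in> A; c \<in> A; d \<in> A\<rbrakk> \<Longrightarrow> I 2 [a, c]"
    and "\<lbrakk>I (proj i) [a, b]; I (proj i) [a, c]; i < M; a \<in> A; b \<in> A; c \<in> A\<rbrakk> \<Longrightarrow> \<not> I 2 [b, c]"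
proof -
  note inst = satisfies_inst[OF sat subsetD[OF base]]
  show "a \<in> A \<Longrightarrow> \<not> I 2 [a, a]"
    using inst[of "base_clauses M ! 0" a "[]"]
    by (simp add: base_clauses_def holds_clause_def holds_atom_def)
  show "\<lbrakk>I 0 [a, a]; I 1 [b, c]; a \<in> A; b \<in> A; c \<in> A\<rbrakk> \<Longrightarrow> I 2 [a, b] \<and> I 2 [b, a]"
    using inst[of "base_clauses M ! 1" a "[b, c]"] inst[of "base_clauses M ! 2" a "[b, c]"]
    by (simp add: base_clauses_def holds_clause_def holds_atom_def)
  show "\<lbrakk>I 1 [a, b]; I 1 [c, d]; I 2 [b, d]; a \<in> A; b \<in> A; c \<in> A; d \<in> A\<rbrakk> \<Longrightarrow> I 2 [a, c]"
    using inst[of "base_clauses M ! 3" a "[b, c, d]"]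
    by (simp add: base_clauses_def holds_clause_def holds_atom_def)
  show "\<lbrakk>I (proj i) [a, b]; I (proj i) [a, c]; i < M; a \<in> A; b \<in> A; c \<in> A\<rbrakk> \<Longrightarrow> \<not> I 2 [b, c]"
    using inst[of "([(proj i, [0, 1]), (proj i, [0, 2]), (2, [1, 2])], None)" a "[b, c]"]
    by (simp add: base_clauses_def holds_clause_def holds_atom_def)
qed

text \<open>Going down both chains in parallel ends at a zero facing a successor, where Neq is
  derivable; the successor clause carries it back up.\<close>

lemma val_neq:
  assumes "satisfies A I \<Phi>" "set (base_clauses M) \<subseteq> set \<Phi>"
  shows "val A I m p \<Longrightarrow> val A I n q \<Longrightarrow> m \<noteq> n \<Longrightarrow> I 2 [p, q]"
proof (induction m arbitrary: n p q)
  case 0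
  then obtain k where "n = Suc k" by (cases n) auto
  with 0 show ?case using base_clauses_neq(2)[OF assms] val_carrier by fastforce
next
  case (Suc m)
  show ?case
  proof (cases n)
    case 0
    with Suc.prems show ?thesis using base_clauses_neq(2)[OF assms] val_carrier by fastforce
  next
    case (Suc k)
    with Suc.prems Suc.IH show ?thesis using base_clauses_neq(3)[OF assms] val_carrier by fastforce
  qed
qed

lemma val_unique:
  assumes "satisfies A I \<Phi>" "set (base_clauses M) \<subseteq> set \<Phi>" "val A I m p" "val A I n p"
  shows "m = n"
  using val_neq[OF assms(1,2)] base_clauses_neq(1)[OF assms(1,2)] assms(3,4) val_carrier by metis

text \<open>Without equality \<open>p\<close> and \<open>q\<close> may be different elements; only
  the numbers they represent must agree, as otherwise Neq would hold between them.\<close>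

lemma val_proj_unique:
  assumes "satisfies A I \<Phi>" "set (base_clauses M) \<subseteq> set \<Phi>" "t \<in> A" "i < M"
    "I (proj i) [t, p]" "I (proj i) [t, q]" "val A I m p" "val A I n q"
  shows "m = n"
  using val_neq[OF assms(1,2)] base_clauses_neq(4)[OF assms(1,2)] assms(3-) val_carrier by metis

section \<open>Putting two models side by side\<close>

text \<open>The relation R between an element a of one model and any element of the other. Since Neq
  is only ever used inside one model, it may hold everywhere across.\<close>

definition cross :: "rule list \<Rightarrow> nat set \<Rightarrow> (nat \<Rightarrow> nat list \<Rightarrow> bool) \<Rightarrow> nat \<Rightarrow> nat \<Rightarrow> bool" where
  "cross P A I R a \<longleftrightarrow> R = 2 \<or> (R = 3 \<and> (\<exists>n. val A I n a)) \<or>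
     (\<exists>r ns. R = good r (length ns) \<and> derivable P r ns \<and>
        (\<forall>i<length ns. \<exists>p. I (proj i) [a, p] \<and> val A I (ns ! i) p))"

text \<open>Disjoint union coded by parity: the even number 2a is the copy of a from
  \<open>A False\<close>, the odd number 2a + 1 the copy from \<open>A True\<close>.\<close>

definition merge_carrier :: "(bool \<Rightarrow> nat set) \<Rightarrow> nat set" where
  "merge_carrier A = {w. w div 2 \<in> A (odd w)}"

definition merge :: "rule list \<Rightarrow> (bool \<Rightarrow> nat set) \<Rightarrow> (bool \<Rightarrow> nat \<Rightarrow> nat list \<Rightarrow> bool)
    \<Rightarrow> nat \<Rightarrow> nat list \<Rightarrow> bool" where
  "merge P A I R xs = (case xs of [a, b] \<Rightarrow>
       if odd a = odd b then I (odd a) R [a div 2, b div 2]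
       else cross P (A (odd a)) (I (odd a)) R (a div 2)
     | _ \<Rightarrow> False)"

lemma merge_pair:
  "merge P A I R [a, b] = (if odd a = odd b then I (odd a) R [a div 2, b div 2]
       else cross P (A (odd a)) (I (odd a)) R (a div 2))"
  unfolding merge_def by simp

lemma cross_symbols [simp]:
  "\<not> cross P A I 0 a" "\<not> cross P A I (Suc 0) a" "cross P A I 2 a"
  "cross P A I 3 a \<longleftrightarrow> (\<exists>n. val A I n a)" "\<not> cross P A I 4 a" "\<not> cross P A I 5 a"
  "\<not> cross P A I (proj i) a"
  "cross P A I (good r l) a \<longleftrightarrow> (\<exists>ns. l = length ns \<and> derivable P r ns \<and>
        (\<forall>i<length ns. \<exists>p. I (proj i) [a, p] \<and> val A I (ns ! i) p))"
  unfolding cross_def by auto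

text \<open>Variables on the other side do not occur in the clause, so they can be redirected to any
  element of the component, and the clause is inherited from the model there.\<close>

lemma merge_same_component:
  assumes sat: "satisfies (A b) (I b) \<Phi>" "c \<in> set \<Phi>" and ne: "A b \<noteq> {}"
    and v: "range v \<subseteq> merge_carrier A"
    and atoms: "\<And>R zs. (R, zs) \<in> set (fst c) \<union> set_option (snd c) \<Longrightarrow>
      \<exists>i j. zs = [i, j] \<and> odd (v i) = b \<and> odd (v j) = b"
  shows "holds_clause (merge P A I) v c"
proof -
  obtain a where a: "a \<in> A b" using ne by blast
  define w where "w i = (if odd (v i) = b then v i div 2 else a)" for i
  have "range w \<subseteq> A b"
    using v a unfolding w_def merge_carrier_def by auto
  then have "holds_clause (I b) w c" using sat unfolding satisfies_def by blast
  moreover have "holds_atom (merge P A I) v at = holds_atom (I b) w at"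
    if "at \<in> set (fst c) \<union> set_option (snd c)" for at
    using atoms[of "fst at" "snd at"] that
    by (auto simp: holds_atom_def merge_pair w_def)
  ultimately show ?thesis unfolding holds_clause_def
    by (auto split: option.splits)
qed


text \<open>A violated instance must lie within one component: Zero, Succ and projections never lead
  across, a Neq head always holds across, and so does a Num head once the premises give a value. But
  within a component nothing is violated.\<close>

lemma merge_base_clause:
  assumes sat: "\<And>b. satisfies (A b) (I b) \<Phi>" and c: "c \<in> set (base_clauses M)" "c \<in> set \<Phi>"
    and ne: "\<And>b. A b \<noteq> {}" and v: "range v \<subseteq> merge_carrier A"
  shows "holds_clause (merge P A I) v c"
proof (rule ccontr)
  assume n: "\<not> holds_clause (merge P A I) v c"
  have A: "v i div 2 \<in> A (odd (v i))" for i
    using v unfolding merge_carrier_def by auto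
  note unf = holds_clause_def holds_atom_def merge_pair
  have "\<forall>(R, zs) \<in> set (fst c) \<union> set_option (snd c).
      \<exists>i j. zs = [i, j] \<and> odd (v i) = odd (v 0) \<and> odd (v j) = odd (v 0)" (is ?side)
    using c(1) unfolding base_clauses_def set_append list.set set_map
  proof (elim UnE insertE emptyE imageE)
    show ?side if "c = ([(2, [0, 0])], None)"
      using that by auto
    show ?side if "c = ([(0, [0, 0]), (1, [1, 2])], Some (2, [0, 1]))"
      using that n by (auto simp: unf split: if_splits)
    show ?side if "c = ([(0, [0, 0]), (1, [1, 2])], Some (2, [1, 0]))"
      using that n by (auto simp: unf split: if_splits)
    show ?side if "c = ([(1, [0, 1]), (1, [2, 3]), (2, [1, 3])], Some (2, [0, 2]))"
      using that n by (auto simp: unf split: if_splits)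
    show ?side if "c = ([(0, [0, 0])], Some (3, [0, 1]))"
      using that n A[of 0] by (auto simp: unf split: if_splits dest: spec[of _ 0])
    show ?side if c: "c = ([(1, [0, 1]), (3, [1, 2])], Some (3, [0, 2]))"
    proof -
      have 1: "odd (v 1) = odd (v 0)" using n c by (auto simp: unf split: if_splits)
      moreover have "odd (v 2) = odd (v 0)"
      proof (rule ccontr)
        \<comment> \<open>Num across gives the element of variable 1 a value k, so that of variable
          0 has the value k + 1 and the head holds across as well.\<close>
        assume "odd (v 2) \<noteq> odd (v 0)"
        with 1 n c obtain k where "val (A (odd (v 0))) (I (odd (v 0))) k (v 1 div 2)"
          "I (odd (v 0)) 1 [v 0 div 2, v 1 div 2]"
          "\<not> (\<exists>k. val (A (odd (v 0))) (I (odd (v 0))) k (v 0 div 2))"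
          by (auto simp: unf)
        then show False using A[of 0] val.simps(2)[of _ _ k "v 0 div 2"] by blast
      qed
      ultimately show ?side using c by auto
    qed
    show ?side if "c = ([(proj i, [0, 1]), (proj i, [0, 2]), (2, [1, 2])], None)" for i
      using that n by (auto simp: unf split: if_splits)
  qed
  then have "holds_clause (merge P A I) v c"
    by (intro merge_same_component[where A = A and I = I and b = "odd (v 0)", OF sat c(2) ne v]) (drule (1) bspec, simp)
  with n show False by blast
qed

lemma rule_vars_mem:
  "x \<in> set (zeros \<rho>) \<Longrightarrow> x \<in> set (rule_vars \<rho>)"
  "(x, y) \<in> set (succs \<rho>) \<Longrightarrow> x \<in> set (rule_vars \<rho>) \<and> y \<in> set (rule_vars \<rho>)"
  "i < length (snd (head \<rho>)) \<Longrightarrow> snd (head \<rho>) ! i \<in> set (rule_vars \<rho>)"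
  "\<lbrakk>k < length (body \<rho>); i < length (snd (body \<rho> ! k))\<rbrakk> \<Longrightarrow> snd (body \<rho> ! k) ! i \<in> set (rule_vars \<rho>)"
proof -
  show "\<lbrakk>k < length (body \<rho>); i < length (snd (body \<rho> ! k))\<rbrakk> \<Longrightarrow> snd (body \<rho> ! k) ! i \<in> set (rule_vars \<rho>)"
    unfolding rule_vars_def by (auto intro!: bexI[of _ "body \<rho> ! k"])
qed (force simp: rule_vars_def)+

text \<open>The Link atoms put everything except \<open>u\<close> into one component. If
  \<open>u\<close> is there too, the clause is inherited; otherwise its premises translate into a
  genuine firing of the rule, and the head is derivable.\<close>

lemma merge_rule_clause:
  assumes sat: "\<And>b. satisfies (A b) (I b) \<Phi>" and ne: "\<And>b. A b \<noteq> {}"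
    and v: "range v \<subseteq> merge_carrier A" and base: "set (base_clauses M) \<subseteq> set \<Phi>"
    and \<rho>: "\<rho> \<in> set P" "rule_clause \<rho> \<in> set \<Phi>"
    and M: "\<And>r ts. (r, ts) \<in> set (body \<rho>) \<Longrightarrow> length ts \<le> M"
  shows "holds_clause (merge P A I) v (rule_clause \<rho>)"
proof (cases "\<forall>a\<in>set (fst (rule_clause \<rho>)). holds_atom (merge P A I) v a")
  case False
  then show ?thesis unfolding holds_clause_def by blast
next
  case True
  let ?b = "odd (v 2)"
  let ?hs = "snd (head \<rho>)" and ?ts = "\<lambda>k. snd (body \<rho> ! k)"
  have A: "v i div 2 \<in> A (odd (v i))" for i
    using v unfolding merge_carrier_def by auto
  from True have
      num: "\<And>x. x \<in> set (rule_vars \<rho>) \<Longrightarrow> merge P A I 3 [v (2 * x + 1), v 0]"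
    and x_link: "\<And>x. x \<in> set (rule_vars \<rho>) \<Longrightarrow> merge P A I 5 [v 2, v (2 * x + 1)]"
    and zero: "\<And>x. x \<in> set (zeros \<rho>) \<Longrightarrow> merge P A I 0 [v (2 * x + 1), v (2 * x + 1)]"
    and succ: "\<And>x y. (x, y) \<in> set (succs \<rho>) \<Longrightarrow> merge P A I 1 [v (2 * x + 1), v (2 * y + 1)]"
    and hproj: "\<And>i. i < length ?hs \<Longrightarrow> merge P A I (proj i) [v 2, v (2 * ?hs ! i + 1)]"
    and t_link: "\<And>k. k < length (body \<rho>) \<Longrightarrow> merge P A I 5 [v 2, v (2 * k + 4)]"
    and good: "\<And>k. k < length (body \<rho>) \<Longrightarrow>
        merge P A I (good (fst (body \<rho> ! k)) (length (?ts k))) [v (2 * k + 4), v 0]"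
    and tproj: "\<And>k i. k < length (body \<rho>) \<Longrightarrow> i < length (?ts k) \<Longrightarrow>
        merge P A I (proj i) [v (2 * k + 4), v (2 * ?ts k ! i + 1)]"
    unfolding rule_clause_body by blast+
  have x_side: "odd (v (2 * x + 1)) = ?b" if "x \<in> set (rule_vars \<rho>)" for x
    using x_link[OF that] by (auto simp: merge_pair split: if_splits)
  have t_side: "odd (v (2 * k + 4)) = ?b" if "k < length (body \<rho>)" for k
    using t_link[OF that] by (auto simp: merge_pair split: if_splits)
  show ?thesis
  proof (cases "odd (v 0) = ?b")
    case True
    have "\<exists>i j. zs = [i, j] \<and> odd (v i) = ?b \<and> odd (v j) = ?b"
      if "(R, zs) \<in> set (fst (rule_clause \<rho>)) \<union> set_option (snd (rule_clause \<rho>))" for R zs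
      using that True x_side t_side rule_vars_mem(1)[of _ \<rho>] rule_vars_mem(2)[of _ _ \<rho>]
        rule_vars_mem(3)[of _ \<rho>] rule_vars_mem(4)[of _ \<rho>]
      unfolding rule_clause_def tuple_atoms_def by (auto simp del: even_Suc)
    then show ?thesis
      by (rule merge_same_component[OF sat \<rho>(2) ne v])
  next
    case False
    let ?V = "val (A ?b) (I ?b)"
    \<comment> \<open>With \<open>u\<close> on the other side, the Num atoms guarantee that every
      rule variable is a number.\<close>
    have "\<exists>n. ?V n (v (2 * x + 1) div 2)" if "x \<in> set (rule_vars \<rho>)" for x
      using num[OF that] x_side[OF that] False by (simp add: merge_pair)
    then obtain nv where nv: "\<And>x. x \<in> set (rule_vars \<rho>) \<Longrightarrow> ?V (nv x) (v (2 * x + 1) div 2)"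
      by metis
    note uniq = val_unique[OF sat base]
    have "nv x = 0" if "x \<in> set (zeros \<rho>)" for x
    proof (rule uniq)
      note x = rule_vars_mem(1)[OF that]
      show "?V (nv x) (v (2 * x + 1) div 2)" using nv[OF x] .
      show "?V 0 (v (2 * x + 1) div 2)"
        using zero[OF that] x_side[OF x] A[of "2 * x + 1"] by (simp add: merge_pair)
    qed
    moreover have "nv x = Suc (nv y)" if "(x, y) \<in> set (succs \<rho>)" for x y
    proof (rule uniq)
      have x: "x \<in> set (rule_vars \<rho>)" and y: "y \<in> set (rule_vars \<rho>)"
        using rule_vars_mem(2)[OF that] by auto
      show "?V (nv x) (v (2 * x + 1) div 2)" using nv[OF x] .
      have "I ?b 1 [v (2 * x + 1) div 2, v (2 * y + 1) div 2]"
        using succ[OF that] x_side[OF x] x_side[OF y] by (simp add: merge_pair)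
      then show "?V (Suc (nv y)) (v (2 * x + 1) div 2)"
        using nv[OF y] x_side[OF x] A[of "2 * x + 1"] by auto
    qed
    moreover have "derivable P (fst (body \<rho> ! k)) (map nv (?ts k))" if k: "k < length (body \<rho>)" for k
    proof -
      obtain ns where ns: "length (?ts k) = length ns" "derivable P (fst (body \<rho> ! k)) ns"
        "\<And>i. i < length ns \<Longrightarrow> \<exists>p. I ?b (proj i) [v (2 * k + 4) div 2, p] \<and> ?V (ns ! i) p"
        using good[OF k] t_side[OF k] False by (auto simp: merge_pair)
      \<comment> \<open>The derived fact behind Good has its own projections; uniqueness identifies
        their numbers with those of the projections named in the clause.\<close>
      have "ns = map nv (?ts k)"
      proof (rule nth_equalityI)
        fix i assume i: "i < length ns"
        then obtain p where p: "I ?b (proj i) [v (2 * k + 4) div 2, p]" "?V (ns ! i) p"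
          using ns(3) by blast
        let ?x = "?ts k ! i"
        have x: "?x \<in> set (rule_vars \<rho>)" using rule_vars_mem(4)[OF k] i ns(1) by simp
        have "I ?b (proj i) [v (2 * k + 4) div 2, v (2 * ?x + 1) div 2]"
          using tproj[OF k i[folded ns(1)]] by (simp only: merge_pair x_side[OF x] t_side[OF k] refl if_True)
        moreover have "i < M" using M[of "fst (body \<rho> ! k)" "?ts k"] k i ns(1) by auto
        moreover have "v (2 * k + 4) div 2 \<in> A ?b" using A[of "2 * k + 4"] t_side[OF k] by simp
        ultimately have "ns ! i = nv ?x"
          using val_proj_unique[OF sat base _ _ p(1) _ p(2)] nv[OF x] by blast
        then show "ns ! i = map nv (?ts k) ! i" using i ns(1) by simp
      qed (use ns in simp)
      with ns(2) show ?thesis by simp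
    qed
    ultimately have "fires (derivable P) nv \<rho>"
      unfolding fires_def by (auto simp: in_set_conv_nth) (metis fst_conv snd_conv)
    from derivable_rule[OF \<rho>(1) this]
    have d: "derivable P (fst (head \<rho>)) (map nv ?hs)" .
    have "I ?b (proj i) [v 2 div 2, v (2 * ?hs ! i + 1) div 2] \<and> ?V (map nv ?hs ! i) (v (2 * ?hs ! i + 1) div 2)"
      if "i < length ?hs" for i
      using hproj[OF that] x_side nv rule_vars_mem(3)[OF that] that by (auto simp: merge_pair)
    with d have "cross P (A ?b) (I ?b) (good (fst (head \<rho>)) (length ?hs)) (v 2 div 2)"
      unfolding cross_symbols by (intro exI[of _ "map nv ?hs"]) (simp, blast)
    with False show ?thesis
      by (simp add: holds_clause_def rule_clause_def holds_atom_def merge_pair)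
  qed
qed

text \<open>If \<open>u\<close> is on the side of the goal tuple, the clause is inherited. Otherwise
  Good comes from a derivable fact, and the projections identify that fact as the goal, which is not
  derivable.\<close>

lemma merge_goal_clause:
  assumes sat: "\<And>b. satisfies (A b) (I b) \<Phi>" and ne: "\<And>b. A b \<noteq> {}"
    and v: "range v \<subseteq> merge_carrier A" and base: "set (base_clauses M) \<subseteq> set \<Phi>" "2 \<le> M"
    and \<Phi>: "goal_clause s x \<in> set \<Phi>" and nd: "\<not> derivable P 0 [s, x]"
  shows "holds_clause (merge P A I) v (goal_clause s x)"
proof (cases "\<forall>a\<in>set (fst (goal_clause s x)). holds_atom (merge P A I) v a")
  case False
  then show ?thesis unfolding holds_clause_def by blast
next
  case True
  let ?b = "odd (v 1)"
  let ?V = "val (A ?b) (I ?b)"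
  have A: "v i div 2 \<in> A (odd (v i))" for i
    using v unfolding merge_carrier_def by auto
  from True have
      p: "merge P A I (proj 0) [v 1, v (s + 2)]" "merge P A I (proj 1) [v 1, v (x + 2)]"
    and succ: "\<And>i. i < s + x \<Longrightarrow> merge P A I 1 [v (i + 3), v (i + 2)]"
    and zero: "merge P A I 0 [v 2, v 2]" and link: "merge P A I 5 [v 1, v 2]"
    and good: "merge P A I (good 0 2) [v 1, v 0]"
    unfolding goal_clause_body by blast+
  \<comment> \<open>Link fixes the side of the element for 0, and Succ, which never holds across,
    keeps the whole chain there.\<close>
  have chain: "odd (v (i + 2)) = ?b \<and> ?V i (v (i + 2) div 2)" if "i \<le> s + x" for i
    using that
  proof (induction i)
    case 0
    have "odd (v 2) = ?b" using link by (auto simp: merge_pair split: if_splits)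
    with zero A[of 2] show ?case by (simp add: merge_pair flip: numeral_2_eq_2)
  next
    case (Suc i)
    then have IH: "odd (v (i + 2)) = ?b" "?V i (v (i + 2) div 2)" and i: "i < s + x" by auto
    have "odd (v (i + 3)) = ?b" "I ?b 1 [v (i + 3) div 2, v (i + 2) div 2]"
      using succ[OF i] IH(1) by (auto simp: merge_pair split: if_splits)
    moreover have "v (i + 3) div 2 \<in> A ?b" using A[of "i + 3"] calculation(1) by simp
    ultimately show ?case using IH by (auto simp: numeral_3_eq_3)
  qed
  show ?thesis
  proof (cases "odd (v 0) = ?b")
    case True
    have side: "odd (v (i + 2)) = ?b" if "i \<le> s + x" for i
      using chain[OF that] by blast
    have "odd (v (i + 3)) = ?b" if "i < s + x" for i
      using side[of "Suc i"] that by (simp add: numeral_3_eq_3)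
    moreover have "odd (v 2) = ?b" "odd (v (s + 2)) = ?b" "odd (v (x + 2)) = ?b"
      "\<And>i. i < s + x \<Longrightarrow> odd (v (i + 2)) = ?b"
      using side[of 0] side[of s] side[of x] side by (simp_all flip: numeral_2_eq_2)
    ultimately have "\<exists>i j. zs = [i, j] \<and> odd (v i) = ?b \<and> odd (v j) = ?b"
      if "(R, zs) \<in> set (fst (goal_clause s x)) \<union> set_option (snd (goal_clause s x))" for R zs
      using that True unfolding goal_clause_def by auto
    then show ?thesis
      by (rule merge_same_component[OF sat \<Phi> ne v])
  next
    case False
    obtain ns where ns: "2 = length ns" "derivable P 0 ns"
        "\<And>i. i < length ns \<Longrightarrow> \<exists>p. I ?b (proj i) [v 1 div 2, p] \<and> ?V (ns ! i) p"
        using good False unfolding merge_pair cross_symbols by metis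
    have eq: "ns ! i = m" if "i < 2" "m \<le> s + x" "merge P A I (proj i) [v 1, v (m + 2)]" for i m
    proof -
      have "i < length ns" using ns(1) that(1) by simp
      then obtain p where p: "I ?b (proj i) [v 1 div 2, p]" "?V (ns ! i) p" using ns(3) by blast
      have "I ?b (proj i) [v 1 div 2, v (m + 2) div 2]"
        using that(3) by (auto simp: merge_pair split: if_splits)
      then show ?thesis
        using val_proj_unique[OF sat base(1) A _ p(1) _ p(2)] that base(2) chain by auto
    qed
    have "ns ! 0 = s" "ns ! 1 = x"
      using eq[OF _ _ p(1)] eq[OF _ _ p(2)] by simp_all
    then have "ns = [s, x]"
      using ns(1) by (intro nth_equalityI) (auto simp: less_2_cases_iff)
    with ns(2) nd show ?thesis by blast
  qed
qed

lemma embedding_binary_iff: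
  "embedding (replicate K 2) A IA B IB f \<longleftrightarrow> inj_on f A \<and> f ` A \<subseteq> B \<and>
     (\<forall>R<K. \<forall>a\<in>A. \<forall>b\<in>A. IA R [a, b] \<longleftrightarrow> IB R [f a, f b])"
proof -
  have "length xs = 2 \<longleftrightarrow> (\<exists>a b. xs = [a, b])" for xs :: "nat list"
    by (auto simp: length_Suc_conv numeral_2_eq_2)
  then show ?thesis unfolding embedding_def by auto
qed

lemma JEP_if_not_derivable:
  assumes M: "2 \<le> M" "\<And>\<rho> r ts. \<rho> \<in> set P \<Longrightarrow> (r, ts) \<in> set (body \<rho>) \<Longrightarrow> length ts \<le> M"
    and nd: "\<not> derivable P 0 [s, x]"
  shows "has_JEP (replicate K 2) (goal_clause s x # horn M P)"
  unfolding has_JEP_def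
proof (intro allI impI)
  let ?\<Phi> = "goal_clause s x # horn M P"
  fix A1 I1 A2 I2
  assume m: "is_finite_model ?\<Phi> A1 I1" "is_finite_model ?\<Phi> A2 I2"
  define A where "A b = (if b then A2 else A1)" for b
  define I where "I b = (if b then I2 else I1)" for b
  have sat: "satisfies (A b) (I b) ?\<Phi>" and ne: "A b \<noteq> {}" and fin: "finite (A b)" for b
    using m unfolding A_def I_def is_finite_model_def finite_structure_def by auto
  have base: "set (base_clauses M) \<subseteq> set ?\<Phi>" unfolding horn_def by auto
  have "holds_clause (merge P A I) v c" if "range v \<subseteq> merge_carrier A" "c \<in> set ?\<Phi>" for v c
  proof -
    from that(2) consider "c = goal_clause s x" | "c \<in> set (base_clauses M)"
      | \<rho> where "\<rho> \<in> set P" "c = rule_clause \<rho>"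
      unfolding horn_def by auto
    then show ?thesis
    proof cases
      case 1
      then show ?thesis using merge_goal_clause[OF sat ne that(1) base M(1) _ nd] by simp
    next
      case 2
      then show ?thesis using merge_base_clause[OF sat _ that(2) ne that(1)] by blast
    next
      case 3
      show ?thesis unfolding 3(2)
        by (rule merge_rule_clause[OF sat ne that(1) base 3(1)]) (use 3 that(2) M(2) in auto)
    qed
  qed
  moreover have carrier: "(\<lambda>a. 2 * a) ` A1 \<subseteq> merge_carrier A" "(\<lambda>a. 2 * a + 1) ` A2 \<subseteq> merge_carrier A"
    unfolding merge_carrier_def A_def by auto
  moreover have "merge_carrier A \<subseteq> (\<lambda>a. 2 * a) ` A1 \<union> (\<lambda>a. 2 * a + 1) ` A2"
  proof
    fix w assume "w \<in> merge_carrier A"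
    then show "w \<in> (\<lambda>a. 2 * a) ` A1 \<union> (\<lambda>a. 2 * a + 1) ` A2"
      unfolding merge_carrier_def A_def
      by (cases "odd w") (auto intro: rev_image_eqI[of "w div 2"])
  qed
  then have "finite (merge_carrier A)"
    by (rule finite_subset) (use fin[of True] fin[of False] in \<open>auto simp: A_def\<close>)
  ultimately have "is_finite_model ?\<Phi> (merge_carrier A) (merge P A I)"
    using ne[of False] unfolding is_finite_model_def finite_structure_def satisfies_def A_def by auto
  moreover have "embedding (replicate K 2) A1 I1 (merge_carrier A) (merge P A I) (\<lambda>a. 2 * a)"
    using carrier(1) unfolding embedding_binary_iff by (auto simp: inj_on_def merge_pair I_def)
  moreover have "embedding (replicate K 2) A2 I2 (merge_carrier A) (merge P A I) (\<lambda>a. 2 * a + 1)"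
    using carrier(2) unfolding embedding_binary_iff by (auto simp: inj_on_def merge_pair I_def)
  ultimately show "\<exists>C IC f g. is_finite_model ?\<Phi> C IC \<and> embedding (replicate K 2) A1 I1 C IC f \<and>
      embedding (replicate K 2) A2 I2 C IC g"
    by blast
qed


section \<open>No joint embedding if the goal is derivable\<close>

definition num :: "nat \<Rightarrow> nat" where
  "num n = prod_encode (0, n)"

definition tup :: "nat list \<Rightarrow> nat" where
  "tup ns = prod_encode (1, list_encode ns)"

lemma num_tup_simps [simp]:
  "num m = num n \<longleftrightarrow> m = n" "tup ms = tup ns \<longleftrightarrow> ms = ns" "num n \<noteq> tup ns" "tup ns \<noteq> num n"
  unfolding num_def tup_def by (auto simp: list_encode_eq)

definition canon_carrier :: "nat \<Rightarrow> nat \<Rightarrow> nat set" where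
  "canon_carrier N M = num ` {..N} \<union> tup ` {ns. set ns \<subseteq> {..N} \<and> length ns \<le> M}"

text \<open>Good holds everywhere, so all rule clauses are true; there is no Marker, so the goal
  clause is true as well.\<close>

definition canon :: "nat \<Rightarrow> nat list \<Rightarrow> bool" where
  "canon R xs = (case xs of [a, b] \<Rightarrow>
       (R = 0 \<and> a = num 0) \<or> (R = 1 \<and> (\<exists>n. a = num (Suc n) \<and> b = num n))
       \<or> (R = 2 \<and> (\<exists>m n. m \<noteq> n \<and> a = num m \<and> b = num n)) \<or> R = 3 \<or> R = 5
       \<or> (\<exists>i ns. R = proj i \<and> a = tup ns \<and> i < length ns \<and> b = num (ns ! i))
       \<or> (\<exists>r l. R = good r l)
     | _ \<Rightarrow> False)"

lemma canon_simps [simp]: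
  "canon 0 [a, b] \<longleftrightarrow> a = num 0"
  "canon (Suc 0) [a, b] \<longleftrightarrow> (\<exists>n. a = num (Suc n) \<and> b = num n)"
  "canon 2 [a, b] \<longleftrightarrow> (\<exists>m n. m \<noteq> n \<and> a = num m \<and> b = num n)"
  "canon 3 [a, b]" "\<not> canon 4 [a, b]" "canon 5 [a, b]"
  "canon (proj i) [a, b] \<longleftrightarrow> (\<exists>ns. a = tup ns \<and> i < length ns \<and> b = num (ns ! i))"
  "canon (good r l) [a, b]"
  unfolding canon_def by auto

lemma canon_model: "is_finite_model (goal_clause s x # horn M P) (canon_carrier N M) canon"
proof -
  have "finite {ns. set ns \<subseteq> {..N} \<and> length ns \<le> M}"
    by (rule finite_lists_length_le) simp
  then have "finite_structure (canon_carrier N M)"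
    unfolding finite_structure_def canon_carrier_def by auto
  moreover have "holds_clause canon v (goal_clause s x)" for v
    unfolding holds_clause_def goal_clause_body by simp
  moreover have "holds_clause canon v c" if "c \<in> set (horn M P)" for v c
    using that unfolding horn_def base_clauses_def
    by (auto simp: holds_clause_def holds_atom_pair rule_clause_def)
  ultimately show ?thesis
    unfolding is_finite_model_def satisfies_def by auto
qed

text \<open>Again Good holds everywhere. There is a Marker but no Zero, so the goal clause is true
  here too.\<close>

definition marker :: "nat \<Rightarrow> nat list \<Rightarrow> bool" where
  "marker R xs \<longleftrightarrow> R = 3 \<or> R = 4 \<or> (\<exists>r l. R = good r l)"

lemma marker_model: "is_finite_model (goal_clause s x # horn M P) {0} marker"
proof -
  have "holds_clause marker v (goal_clause s x)" for v
    unfolding holds_clause_def goal_clause_body by (simp add: marker_def)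
  moreover have "holds_clause marker v c" if "c \<in> set (horn M P)" for v c
    using that unfolding horn_def base_clauses_def
    by (auto simp: holds_clause_def holds_atom_pair rule_clause_def marker_def)
  ultimately show ?thesis
    unfolding is_finite_model_def satisfies_def finite_structure_def by auto
qed

text \<open>With \<open>u\<close> the image of the marked point in a joint extension, the tuples in
  relation Good to \<open>u\<close> are closed under the rules, because the extension satisfies the
  rule clauses. Hence the goal tuple is among them, and the goal clause is violated.\<close>

lemma not_JEP_if_derivable:
  assumes M: "2 \<le> M"
      "\<And>\<rho> r ts. \<rho> \<in> set P \<Longrightarrow> (r, ts) \<in> insert (head \<rho>) (set (body \<rho>)) \<Longrightarrow> length ts \<le> M"
    and K: "proj M < K" and der: "derivable P 0 [s, x]"
  shows "\<not> has_JEP (replicate K 2) (goal_clause s x # horn M P)"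
proof
  let ?\<Phi> = "goal_clause s x # horn M P"
  assume JEP: "has_JEP (replicate K 2) ?\<Phi>"
  from der obtain N0 where N0: "\<And>G. closed_upto N0 P G \<Longrightarrow> G 0 [s, x]"
    unfolding derivable_def by blast
  \<comment> \<open>The chain must be long enough both for the derivation and for the s + x
    successor atoms of the goal clause.\<close>
  define N where "N = N0 + s + x"
  let ?A = "canon_carrier N M"
  obtain C IC f g where C: "is_finite_model ?\<Phi> C IC"
    and f: "embedding (replicate K 2) ?A canon C IC f"
    and g: "embedding (replicate K 2) {0} marker C IC g"
    using JEP[unfolded has_JEP_def, rule_format, OF canon_model[of s x M P N] marker_model] by blast
  have holds: "holds_clause IC v c" if "c \<in> set ?\<Phi>" "range v \<subseteq> C" for v c
    using C that unfolding is_finite_model_def satisfies_def by blast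
  have f_carrier: "f a \<in> C" if "a \<in> ?A" for a
    using f that unfolding embedding_binary_iff by blast
  have "4 < K" using K by (simp add: proj_def)
  with g have u: "g 0 \<in> C" "IC 4 [g 0, g 0]"
    unfolding embedding_binary_iff marker_def by blast+
  have num: "num (min n N) \<in> ?A" for n
    unfolding canon_carrier_def by auto
  have tup: "tup ns \<in> ?A" if "set ns \<subseteq> {..N}" "length ns \<le> M" for ns
    using that unfolding canon_carrier_def by auto
  have transfer: "IC R [f a, f b]" if "R \<le> 5 \<or> (\<exists>i<M. R = proj i)" "canon R [a, b]" "a \<in> ?A" "b \<in> ?A" for R a b
  proof -
    have "R < K" using that(1) K by (auto simp: proj_def)
    with f that(2-) show ?thesis unfolding embedding_binary_iff by blast
  qed
  \<comment> \<open>The element \<open>g 0\<close> comes from the other model, so these Num atoms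
    are not transferred by \<open>f\<close> but derived along the chain in the extension.\<close>
  have IC_num: "IC 3 [f (num n), g 0]" if "n \<le> N" for n
    using that
  proof (induction n)
    case 0
    let ?c = "([(0, [0, 0])], Some (3, [0, 1]))"
    have "holds_clause IC (\<lambda>i. if i = 0 then f (num 0) else g 0) ?c"
      by (rule holds) (use f_carrier num[of 0] u in \<open>auto simp: horn_def base_clauses_def\<close>)
    then show ?case using transfer[of 0 "num 0" "num 0"] num[of 0]
      by (simp add: holds_clause_def holds_atom_pair)
  next
    case (Suc n)
    let ?c = "([(1, [0, 1]), (3, [1, 2])], Some (3, [0, 2]))"
    have mem: "num (Suc n) \<in> ?A" "num n \<in> ?A" using num[of n] num[of "Suc n"] Suc.prems by (auto simp: min_def)
    have "holds_clause IC (\<lambda>i. if i = 0 then f (num (Suc n)) else if i = 1 then f (num n) else g 0) ?c"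
      by (rule holds) (use f_carrier mem u in \<open>auto simp: horn_def base_clauses_def\<close>)
    then show ?case using transfer[of 1 "num (Suc n)" "num n"] mem Suc
      by (simp add: holds_clause_def holds_atom_pair)
  qed
  define G where "G r ns \<longleftrightarrow> IC (good r (length ns)) [f (tup ns), g 0]" for r ns
  have "closed_upto N P G"
    unfolding closed_upto_def
  proof (intro ballI allI impI)
    fix \<rho> v
    assume \<rho>: "\<rho> \<in> set P" and v: "\<forall>x\<in>set (rule_vars \<rho>). v x \<le> N" and fires: "fires G v \<rho>"
    let ?hs = "snd (head \<rho>)" and ?ts = "\<lambda>k. snd (body \<rho> ! k)"
    \<comment> \<open>Inverts the variable numbering of \<open>rule_clause\<close>. The cutoff at
      \<open>N\<close> and the default \<open>g 0\<close> keep the values of all other variables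
      inside \<open>C\<close>.\<close>
    define w where "w j = (if j = 0 then g 0 else if odd j then f (num (min (v (j div 2)) N))
        else if j = 2 then f (tup (map v ?hs))
        else if j div 2 - 2 < length (body \<rho>) then f (tup (map v (?ts (j div 2 - 2)))) else g 0)" for j
    have hs: "tup (map v ?hs) \<in> ?A"
      using v M(2)[OF \<rho>, of "fst (head \<rho>)" ?hs] by (intro tup) (auto simp: rule_vars_def)
    have ts: "tup (map v (?ts k)) \<in> ?A" "length (?ts k) \<le> M" if k: "k < length (body \<rho>)" for k
    proof -
      show l: "length (?ts k) \<le> M"
        using M(2)[OF \<rho>, of "fst (body \<rho> ! k)" "?ts k"] k by simp
      have "set (map v (?ts k)) \<subseteq> {..N}"
        using v rule_vars_mem(4)[OF k] by (auto simp: in_set_conv_nth)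
      then show "tup (map v (?ts k)) \<in> ?A" using l by (intro tup) auto
    qed
    have w: "w 0 = g 0" "w 2 = f (tup (map v ?hs))"
      "\<And>x. x \<in> set (rule_vars \<rho>) \<Longrightarrow> w (2 * x + 1) = f (num (v x))"
      "\<And>k. k < length (body \<rho>) \<Longrightarrow> w (2 * k + 4) = f (tup (map v (?ts k)))"
      using v unfolding w_def by (auto simp: min_def)
    have "w j \<in> C" for j
      using u(1) f_carrier num hs ts unfolding w_def by auto
    then have "holds_clause IC w (rule_clause \<rho>)"
      using \<rho> by (intro holds) (auto simp: horn_def)
    moreover have "\<forall>a\<in>set (fst (rule_clause \<rho>)). holds_atom IC w a"
      unfolding rule_clause_body
    proof (intro conjI ballI allI impI; (clarify)?)
      have nm: "num (v x) \<in> ?A" if "x \<in> set (rule_vars \<rho>)" for x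
        using num[of "v x"] v that by (simp add: min_def)
      note vars = rule_vars_mem
      show "IC 3 [w (2 * x + 1), w 0]" if "x \<in> set (rule_vars \<rho>)" for x
        unfolding w(1) w(3)[OF that] using that IC_num v by blast
      show "IC 5 [w 2, w (2 * x + 1)]" if "x \<in> set (rule_vars \<rho>)" for x
        unfolding w(2) w(3)[OF that] using transfer[of 5] hs nm[OF that] by simp
      show "IC 0 [w (2 * x + 1), w (2 * x + 1)]" if "x \<in> set (zeros \<rho>)" for x
      proof -
        have "v x = 0" using fires that by (simp add: fires_def)
        then have "IC 0 [f (num (v x)), f (num (v x))]"
          using transfer[of 0 "num 0" "num 0"] nm[OF vars(1)[OF that]] by simp
        then show ?thesis unfolding w(3)[OF vars(1)[OF that]] .
      qed
      show "IC 1 [w (2 * x + 1), w (2 * y + 1)]" if "(x, y) \<in> set (succs \<rho>)" for x y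
      proof -
        have xy: "x \<in> set (rule_vars \<rho>)" "y \<in> set (rule_vars \<rho>)" using vars(2)[OF that] by auto
        have "v x = Suc (v y)" using fires that by (auto simp: fires_def)
        then have "IC 1 [f (num (v x)), f (num (v y))]"
          using transfer[of 1 "num (v x)" "num (v y)"] nm[OF xy(1)] nm[OF xy(2)] by simp
        then show ?thesis unfolding w(3)[OF xy(1)] w(3)[OF xy(2)] .
      qed
      show "IC (proj i) [w 2, w (2 * ?hs ! i + 1)]" if i: "i < length ?hs" for i
      proof -
        note x = vars(3)[OF i]
        have "i < M" using M(2)[OF \<rho>, of "fst (head \<rho>)" ?hs] i by simp
        then have "IC (proj i) [f (tup (map v ?hs)), f (num (v (?hs ! i)))]"
          using transfer[of "proj i" "tup (map v ?hs)"] hs nm[OF x] i by simp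
        then show ?thesis unfolding w(2) w(3)[OF x] .
      qed
      fix k assume k: "k < length (body \<rho>)"
      show "IC 5 [w 2, w (2 * k + 4)]"
        unfolding w(2) w(4)[OF k] using transfer[of 5] hs ts(1)[OF k] by simp
      have "G (fst (body \<rho> ! k)) (map v (?ts k))"
        using fires nth_mem[OF k] unfolding fires_def by (auto simp: case_prod_unfold)
      then show "IC (good (fst (body \<rho> ! k)) (length (?ts k))) [w (2 * k + 4), w 0]"
        unfolding w(1) w(4)[OF k] by (simp add: G_def)
      show "IC (proj i) [w (2 * k + 4), w (2 * ?ts k ! i + 1)]" if i: "i < length (?ts k)" for i
      proof -
        note x = vars(4)[OF k i]
        have "i < M" using ts(2)[OF k] i by simp
        then have "IC (proj i) [f (tup (map v (?ts k))), f (num (v (?ts k ! i)))]"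
          using transfer[of "proj i" "tup (map v (?ts k))"] ts(1)[OF k] nm[OF x] i by simp
        then show ?thesis unfolding w(4)[OF k] w(3)[OF x] .
      qed
    qed
    ultimately show "G (fst (head \<rho>)) (map v ?hs)"
      by (simp add: holds_clause_def rule_clause_def holds_atom_pair w G_def)
  qed
  then have "closed_upto N0 P G"
    by (rule closed_upto_antimono) (simp add: N_def)
  then have goal: "G 0 [s, x]" by (rule N0)
  define w where "w j = (if j = 0 then g 0 else if j = 1 then f (tup [s, x]) else f (num (min (j - 2) N)))" for j
  have sx: "tup [s, x] \<in> ?A"
    using M(1) by (intro tup) (auto simp: N_def)
  have w: "w 0 = g 0" "w 1 = f (tup [s, x])" "\<And>i. w (i + 2) = f (num (min i N))"
    unfolding w_def by auto
  have w': "w 2 = f (num 0)" "\<And>i. w (i + 3) = f (num (min (Suc i) N))"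
    unfolding w_def by (simp_all add: numeral_3_eq_3)
  have "w j \<in> C" for j
    using u(1) f_carrier num sx unfolding w_def by auto
  then have "holds_clause IC w (goal_clause s x)"
    by (intro holds) auto
  moreover have "\<forall>a\<in>set (fst (goal_clause s x)). holds_atom IC w a"
    unfolding goal_clause_body
  proof (intro conjI allI impI)
    have s: "min s N = s" and x: "min x N = x" unfolding N_def by auto
    show "IC (proj 0) [w 1, w (s + 2)]"
      unfolding w s using transfer[of "proj 0"] sx num[of s] M(1) s by auto
    show "IC (proj 1) [w 1, w (x + 2)]"
      unfolding w x using transfer[of "proj 1"] sx num[of x] M(1) x by auto
    show "IC 1 [w (i + 3), w (i + 2)]" if "i < s + x" for i
    proof -
      have "Suc i \<le> N" using that unfolding N_def by simp
      then show ?thesis unfolding w w' using transfer[of 1] num[of i] num[of "Suc i"] by (simp add: min_def)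
    qed
    show "IC 0 [w 2, w 2]" unfolding w' using transfer[of 0] num[of 0] by simp
    show "IC 5 [w 1, w 2]" unfolding w w' using transfer[of 5] num[of 0] sx by simp
    show "IC 4 [w 0, w 0]" unfolding w using u by simp
    show "IC (good 0 2) [w 1, w 0]" unfolding w using goal by (simp add: G_def numeral_2_eq_2)
  qed
  ultimately show False by (simp add: holds_clause_def goal_clause_def)
qed

section \<open>Diagonalization\<close>

text \<open>Because of the \<open>rev\<close> in \<open>goal_clause\<close>, passing from n to n + 1
  puts one atom in front of the list, which is a primitive recursion step on list codes.\<close>

definition goal_atoms_recf :: recf where
  "goal_atoms_recf = Pr
     (const_recf (list_encode (map enc_atom [(0, [2, 2]), (5, [1, 2]), (4, [0, 0]), (good 0 2, [1, 0])])))
     (cons_recf (atom_recf 1 (Cn add_recf [const_recf 3, Id 0]) (Cn add_recf [const_recf 2, Id 0])) (Id 1))"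

lemma rec_eval_goal_atoms:
  "rec_eval goal_atoms_recf [n] (list_encode (map enc_atom
     (map (\<lambda>i. (1, [i + 3, i + 2])) (rev [0..<n]) @ [(0, [2, 2]), (5, [1, 2]), (4, [0, 0]), (good 0 2, [1, 0])])))"
proof (induction n)
  case 0
  show ?case unfolding goal_atoms_recf_def 
    by (simp only: upt_0 rev.simps list.map append_Nil) (intro ev_Pr0 rec_eval_const)
next
  case (Suc n)
  let ?base = "[(0, [2, 2]), (5, [1, 2]), (4, [0, 0]), (good 0 2, [1, 0])] :: atom list"
  let ?l = "map enc_atom (map (\<lambda>i. (1, [i + 3, i + 2])) (rev [0..<n]) @ ?base)"
  have "rec_eval (cons_recf (atom_recf 1 (Cn add_recf [const_recf 3, Id 0]) (Cn add_recf [const_recf 2, Id 0])) (Id 1))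
     [n, list_encode ?l] (list_encode (enc_atom (1, [3 + n, 2 + n]) # ?l))"
    by (intro rec_eval_cons rec_eval_atom rec_eval_Cn2[OF rec_eval_const _ rec_eval_add] rec_eval_Id) auto
  with Suc show ?case unfolding goal_atoms_recf_def
    by (auto intro!: ev_PrS[where y = "list_encode ?l"] simp: add.commute)
qed

text \<open>The second argument already codes the remaining clauses, so only the code of the goal
  clause is put in front. The second component \<open>Z\<close> of its pair codes the missing
  positive atom.\<close>

definition instance_recf :: recf where
  "instance_recf = pair_recf (Id 0) (cons_recf
     (pair_recf (cons_recf (atom_recf (proj 0) (const_recf 1) (Cn add_recf [const_recf 2, Id 0]))
        (cons_recf (atom_recf (proj 1) (const_recf 1) (Cn add_recf [const_recf 2, Id 1]))
          (Cn goal_atoms_recf [add_recf]))) Z) (Id 1))"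

lemma rec_eval_instance:
  "rec_eval instance_recf [list_encode sig, list_encode (map enc_clause \<Phi>)]
     (enc_instance sig (goal_clause (list_encode sig) (list_encode (map enc_clause \<Phi>)) # \<Phi>))"
proof -
  let ?s = "list_encode sig" and ?x = "list_encode (map enc_clause \<Phi>)"
  let ?l = "map enc_atom (map (\<lambda>i. (1, [i + 3, i + 2])) (rev [0..<?s + ?x])
     @ [(0, [2, 2]), (5, [1, 2]), (4, [0, 0]), (good 0 2, [1, 0])])"
  have "rec_eval (Cn goal_atoms_recf [add_recf]) [?s, ?x] (list_encode ?l)"
    by (rule rec_eval_Cn1[OF rec_eval_add rec_eval_goal_atoms])
  then have "rec_eval instance_recf [?s, ?x] (prod_encode (?s, list_encode
     (prod_encode (list_encode (enc_atom (proj 0, [1, 2 + ?s]) # enc_atom (proj 1, [1, 2 + ?x]) # ?l), 0)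
       # map enc_clause \<Phi>)))"
    unfolding instance_recf_def
    by (intro rec_eval_pair rec_eval_cons rec_eval_atom rec_eval_const rec_eval_Cn2[OF rec_eval_const _ rec_eval_add]
        rec_eval_Id ev_Z) auto
  then show ?thesis
    by (simp add: enc_instance_def enc_clause_def goal_clause_def add.commute)
qed

lemma binary_undecidable: "\<not> JEP_decidable_on (\<lambda>sig \<Phi>. \<forall>k\<in>set sig. k \<le> 2)"
proof
  assume "JEP_decidable_on (\<lambda>sig \<Phi>. \<forall>k\<in>set sig. k \<le> 2)"
  then obtain f where f: "\<And>sig \<Phi>. wf_sentence sig \<Phi> \<Longrightarrow> \<forall>k\<in>set sig. k \<le> 2 \<Longrightarrow>
      rec_eval f [enc_instance sig \<Phi>] (if has_JEP sig \<Phi> then 1 else 0)"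
    unfolding JEP_decidable_on_def by blast
  define F where "F = Cn f [instance_recf]"
  define P where "P = program F"
  define M where "M = Max (insert 2 (\<Union>\<rho>\<in>set P. (length \<circ> snd) ` insert (head \<rho>) (set (body \<rho>))))"
  have M: "2 \<le> M" unfolding M_def by (intro Max_ge) auto
  have M': "length ts \<le> M" if "\<rho> \<in> set P" "(r, ts) \<in> insert (head \<rho>) (set (body \<rho>))" for \<rho> r ts
  proof -
    have "(length \<circ> snd) (r, ts) \<in> (\<Union>\<rho>\<in>set P. (length \<circ> snd) ` insert (head \<rho>) (set (body \<rho>)))"
      using that by blast
    then show ?thesis unfolding M_def by (intro Max_ge) auto
  qed
  let ?symbols = "\<lambda>c :: horn_clause. fst ` (set (fst c) \<union> set_option (snd c))"
  \<comment> \<open>Neither \<open>P\<close>, \<open>M\<close> nor \<open>K\<close> depends on the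
    codes \<open>s\<close> and \<open>x\<close>, so these can be defined afterwards from the
    finished signature and clauses.\<close>
  define K where "K = Suc (Max (insert (good 0 2) (insert (proj M) (\<Union>c\<in>set (horn M P). ?symbols c))))"
  have K: "proj M < K" "good 0 2 < K" "\<And>c R. c \<in> set (horn M P) \<Longrightarrow> R \<in> ?symbols c \<Longrightarrow> R < K"
    unfolding K_def by (auto intro!: Max_ge simp: less_Suc_eq_le simp del: Max_insert)
  let ?sig = "replicate K 2"
  define s where "s = list_encode ?sig"
  define x where "x = list_encode (map enc_clause (horn M P))"
  let ?\<Phi> = "goal_clause s x # horn M P"
  have "\<not> has_JEP ?sig ?\<Phi>" if "derivable P 0 [s, x]"
    by (rule not_JEP_if_derivable[OF M _ K(1) that]) (rule M')
  moreover have "has_JEP ?sig ?\<Phi>" if "\<not> derivable P 0 [s, x]"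
    by (rule JEP_if_not_derivable[OF M _ that]) (rule M', auto)
  ultimately have JEP_iff: "has_JEP ?sig ?\<Phi> \<longleftrightarrow> \<not> rec_eval F [s, x] 1"
    unfolding derivable_program[symmetric] P_def[symmetric] by blast
  have "wf_clause ?sig (goal_clause s x)"
    using K(1,2) M unfolding wf_clause_def wf_atom_def goal_clause_def by (auto simp: proj_def)
  moreover have "wf_clause ?sig c" if c: "c \<in> set (horn M P)" for c
  proof -
    have "\<forall>a \<in> set (fst c) \<union> set_option (snd c). length (snd a) = 2"
      using c unfolding horn_def base_clauses_def rule_clause_def tuple_atoms_def by auto
    then show ?thesis using K(3)[OF c] unfolding wf_clause_def wf_atom_def by auto
  qed
  ultimately have "rec_eval f [enc_instance ?sig ?\<Phi>] (if has_JEP ?sig ?\<Phi> then 1 else 0)"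
    by (intro f) (auto simp: wf_sentence_def)
  moreover have "rec_eval instance_recf [s, x] (enc_instance ?sig ?\<Phi>)"
    unfolding s_def x_def by (rule rec_eval_instance)
  ultimately have "rec_eval F [s, x] (if has_JEP ?sig ?\<Phi> then 1 else 0)"
    unfolding F_def by (intro rec_eval_Cn1)
  \<comment> \<open>By the choice of \<open>F\<close> its value is 1 exactly if the JEP holds,
    whereas \<open>JEP_iff\<close> says the opposite; determinism excludes the values 0 and 1
    together.\<close>
  with JEP_iff show False
    using rec_eval_deterministic[of F "[s, x]" 0 1] by (auto split: if_splits)
qed

text \<open>A decider for all signatures would in particular decide the instances of arity at most
  two.\<close>

theorem theorem3:
  shows "\<not> JEP_decidable_on (\<lambda>sig \<Phi>. True)
       \<and> \<not> JEP_decidable_on (\<lambda>sig \<Phi>. \<forall>k\<in>set sig. k \<le> 2)"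
  using binary_undecidable unfolding JEP_decidable_on_def by blast

end
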